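(* Let $X$ be a partially ordered normed space whose ordering cone $\mathcal{C}$ is closed, convex and pointed, let $x_0\in A\subset X$, $\varepsilon\ge0$, and $D\in\overline{\mathcal{H}}$. If there exists $(f,\alpha)\in\mathcal{C}^{a\#}_+$ such that $f(x-x_0)+\alpha\|x-x_0\|\ge0$ for every $x\in A+D(\varepsilon)$, then $x_0\in\mathrm{Be}(A,\mathcal{C},D,\varepsilon)$.
   Context: $X$ is a real normed space with origin $0_X$ and dual $X^*$. For $S\subset X$: $\mathrm{cone}(S):=\{\lambda s:\lambda\ge0,\ s\in S\}$ and $\overline{\mathrm{cone}}(S)$ is its closure. A cone is a set closed under multiplication by all $\lambda\ge0$; the ordering cone $\mathcal{C}$ is non-trivial (different from $\{0_X\}$ and $X$). Pointed means $(-\mathcal{C})\cap\mathcal{C}=\{0_X\}$. For non-empty $D\subset X\setminus\{0_X\}$: $D(\varepsilon):=\varepsilon D$ if $\varepsilon>0$, and $D(0):=\mathrm{cone}(D)\setminus\{0_X\}$. $\overline{\mathcal{H}}:=\{\emptyset\ne D\subset X\setminus\{0_X\}:\overline{\mathrm{cone}}(D)\cap(-\mathcal{C})=\{0_X\}\}$. $x_0\in\mathrm{Be}(A,\mathcal{C},D,\varepsilon)$ (Benson $(D,\varepsilon)$-efficient point) means $x_0\in A$ and $\overline{\mathrm{cone}}(A+D(\varepsilon)-x_0)\cap(-\mathcal{C})=\{0_X\}$. $\mathcal{C}^{\#}:=\{f\in X^*: f(x)>0\ \forall x\in\mathcal{C},\ x\neq0_X\}$ and $\mathcal{C}^{a\#}_+:=\{(f,\alpha)\in\mathcal{C}^{\#}\times(0,\infty):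 f(x)-\alpha\|x\|>0\ \forall x\in\mathcal{C},\ x\neq0_X\}$. *)

theory Defs
  imports "HOL-Analysis.Analysis" "HOL-Library.Set_Algebras"
begin

text \<open>On sets, unary and binary minus are the library's complement and difference, so the
  negative of a set and the translate by a negative vector are written as images throughout.
  The binary plus on sets is the Minkowski sum of \<open>Set_Algebras\<close>.\<close>

definition gen_cone :: "'a::real_vector set \<Rightarrow> 'a set" where
  "gen_cone S = {l *\<^sub>R s | l s. 0 \<le> l \<and> s \<in> S}"

lemma gen_cone_eq_cone_hull: "gen_cone S = cone hull S"
  by (simp add: gen_cone_def cone_hull_expl)

abbreviation closed_cone :: "'a::real_normed_vector set \<Rightarrow> 'a set" where
  "closed_cone S \<equiv> closure (gen_cone S)"

text \<open>The library predicate \<^const>\<open>cone\<close> also holds of the empty set; \<open>pointed\<close> excludes it.\<close>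

definition nontrivial_cone :: "'a::real_vector set \<Rightarrow> bool" where
  "nontrivial_cone C \<longleftrightarrow> cone C \<and> C \<noteq> {0} \<and> C \<noteq> UNIV"

definition pointed :: "'a::real_vector set \<Rightarrow> bool" where
  "pointed C \<longleftrightarrow> uminus ` C \<inter> C = {0}"

text \<open>The set \<open>D(\<epsilon>)\<close>; only \<open>\<epsilon> \<ge> 0\<close> is meaningful, and the value for negative \<open>\<epsilon>\<close> is junk.\<close>

definition eps_set :: "'a::real_vector set \<Rightarrow> real \<Rightarrow> 'a set" where
  "eps_set D \<epsilon> = (if \<epsilon> > 0 then (\<lambda>d. \<epsilon> *\<^sub>R d) ` D else gen_cone D - {0})"

definition H_bar :: "'a::real_normed_vector set \<Rightarrow> 'a set set" where
  "H_bar C = {D. D \<noteq> {} \<and> D \<subseteq> UNIV - {0} \<and> closed_cone D \<inter> uminus ` C = {0}}"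

definition Benson :: "'a::real_normed_vector set \<Rightarrow> 'a set \<Rightarrow> 'a set \<Rightarrow> real \<Rightarrow> 'a set" where
  "Benson A C D \<epsilon> =
     {x\<^sub>0 \<in> A. closed_cone ((\<lambda>y. y - x\<^sub>0) ` (A + eps_set D \<epsilon>)) \<inter> uminus ` C = {0}}"

definition dual_sharp :: "'a::real_normed_vector set \<Rightarrow> ('a \<Rightarrow>\<^sub>L real) set" where
  "dual_sharp C = {f. \<forall>x\<in>C. x \<noteq> 0 \<longrightarrow> blinfun_apply f x > 0}"

definition aug_dual_sharp :: "'a::real_normed_vector set \<Rightarrow> (('a \<Rightarrow>\<^sub>L real) \<times> real) set" where
  "aug_dual_sharp C =
     {(f, \<alpha>) \<in> dual_sharp C \<times> {0<..}. \<forall>x\<in>C. x \<noteq> 0 \<longrightarrow> blinfun_apply f x - \<alpha> * norm x > 0}"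

end

theory Submission
  imports Defs
begin

text \<open>The function \<open>y \<mapsto> f y + \<alpha> \<parallel>y\<parallel>\<close> is continuous and positively homogeneous, so its
  nonnegativity passes from a set to the closed cone that the set generates, whereas it is
  negative on the nonzero elements of \<open>- C\<close>.\<close>

lemma closed_cone_nonneg:
  fixes S :: "'a::real_normed_vector set" and f :: "'a \<Rightarrow>\<^sub>L real"
  assumes "\<And>y. y \<in> S \<Longrightarrow> 0 \<le> blinfun_apply f y + \<alpha> * norm y"
    and "y \<in> closed_cone S"
  shows "0 \<le> blinfun_apply f y + \<alpha> * norm y"
proof -
  let ?N = "{y. 0 \<le> blinfun_apply f y + \<alpha> * norm y}"
  have "0 \<le> blinfun_apply f (l *\<^sub>R s) + \<alpha> * norm (l *\<^sub>R s)" if "0 \<le> l" "s \<in> S" for l s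
  proof -
    \<comment> \<open>The sign of \<open>l\<close> matters here: the norm scales by |l|, which
      equals \<open>l\<close> because \<open>0 \<le> l\<close>.\<close>
    have "blinfun_apply f (l *\<^sub>R s) + \<alpha> * norm (l *\<^sub>R s) = l * (blinfun_apply f s + \<alpha> * norm s)"
      using that by (simp add: blinfun.scaleR_right algebra_simps)
    then show ?thesis using assms(1) that by simp
  qed
  then have "gen_cone S \<subseteq> ?N"
    unfolding gen_cone_def by blast
  moreover have "closed ?N"
    by (intro closed_Collect_le continuous_intros)
  ultimately show ?thesis
    using assms(2) closure_minimal by blast
qed

text \<open>The multiplier 0 is allowed in \<open>gen_cone\<close>, so any element of
  \<open>S\<close> yields the origin. Benson efficiency demands equality with \<open>{0}\<close>,
  hence also this membership.\<close>

lemma zero_in_closed_cone: "S \<noteq> {} \<Longrightarrow> 0 \<in> closed_cone S"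
proof -
  assume "S \<noteq> {}"
  then obtain s where "s \<in> S" by blast
  then have "0 *\<^sub>R s \<in> gen_cone S"
    unfolding gen_cone_def by blast
  then show ?thesis
    using closure_subset by auto
qed

lemma eps_set_nonempty:
  assumes "D \<noteq> {}" and "0 \<notin> D"
  shows "eps_set D \<epsilon> \<noteq> {}"
proof -
  obtain d where "d \<in> D" "d \<noteq> 0"
    using assms by auto
  \<comment> \<open>The multiplier 1 keeps \<open>d\<close> itself in the cone; being nonzero, it
    survives the removal of 0 in the case \<epsilon> = 0.\<close>
  moreover from \<open>d \<in> D\<close> have "1 *\<^sub>R d \<in> gen_cone D"
    unfolding gen_cone_def using zero_le_one by blast
  ultimately show ?thesis
    by (auto simp: eps_set_def)
qed

theorem theorem4p2:
  fixes C A D :: "'a::real_normed_vector set" and x\<^sub>0 :: 'a and \<epsilon> :: real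
  assumes "nontrivial_cone C" and "closed C" and "convex C" and "pointed C"
    and "x\<^sub>0 \<in> A"
    and "\<epsilon> \<ge> 0"
    and "D \<in> H_bar C"
    and "\<exists>(f, \<alpha>) \<in> aug_dual_sharp C.
           \<forall>x \<in> A + eps_set D \<epsilon>. blinfun_apply f (x - x\<^sub>0) + \<alpha> * norm (x - x\<^sub>0) \<ge> 0"
  shows "x\<^sub>0 \<in> Benson A C D \<epsilon>"
proof -
  let ?S = "(\<lambda>y. y - x\<^sub>0) ` (A + eps_set D \<epsilon>)"
  obtain f \<alpha> where pos: "\<And>x. x \<in> C \<Longrightarrow> x \<noteq> 0 \<Longrightarrow> blinfun_apply f x - \<alpha> * norm x > 0"
    and "\<forall>x \<in> A + eps_set D \<epsilon>. blinfun_apply f (x - x\<^sub>0) + \<alpha> * norm (x - x\<^sub>0) \<ge> 0"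
    using assms(8) unfolding aug_dual_sharp_def by blast
  then have nonneg: "0 \<le> blinfun_apply f y + \<alpha> * norm y" if "y \<in> closed_cone ?S" for y
    by (intro closed_cone_nonneg[OF _ that]) blast
  have "eps_set D \<epsilon> \<noteq> {}"
    using assms(7) by (intro eps_set_nonempty) (auto simp: H_bar_def)
  then have "?S \<noteq> {}"
    using \<open>x\<^sub>0 \<in> A\<close> by (auto simp: set_plus_def)
  then have "0 \<in> closed_cone ?S"
    by (rule zero_in_closed_cone)
  \<comment> \<open>The predicate \<open>cone\<close> would allow an empty \<open>C\<close>;
    pointedness supplies the origin.\<close>
  moreover have "0 \<in> uminus ` C"
    using \<open>pointed C\<close> by (auto simp: pointed_def)
  moreover have "y = 0" if "y \<in> closed_cone ?S" "y \<in> uminus ` C" for y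
  proof (rule ccontr)
    assume "y \<noteq> 0"
    with \<open>y \<in> uminus ` C\<close> obtain c where "c \<in> C" "y = - c" "c \<noteq> 0"
      by (metis imageE neg_equal_0_iff_equal)
    \<comment> \<open>At y = -c, \<open>nonneg\<close> reads f c \<le> \<alpha> * norm c, the
      opposite of the strict inequality \<open>pos\<close> at c.\<close>
    with pos[of c] nonneg[OF that(1)] show False
      by (simp add: blinfun.minus_right)
  qed
  ultimately have "closed_cone ?S \<inter> uminus ` C = {0}"
    by (intro set_eqI iffI; metis IntE IntI singletonD singletonI)
  then show ?thesis
    using \<open>x\<^sub>0 \<in> A\<close> by (simp add: Benson_def)
qed

end
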